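(* Let $\mathcal{I}_n$ be the subposet of the middle order $\mathcal{P}_n$ consisting of the involutions of size $n$ (with the induced order), and let $\mu$ be its Möbius function. Fix $w\in\mathcal{I}_n$ and let $\alpha$ be the number of nonzero entries of $I(w)$. Then $$\mu(e_n,w)=\begin{cases}(-1)^\alpha & \text{if } w \text{ is slow-climbing},\\ 0 & \text{otherwise.}\end{cases}$$
   Context: $e_n$ is the identity permutation of size $n$. For $w\in S_n$ (one-line notation), its inversion sequence is $I(w)=(x_1,\ldots,x_n)$ with $x_i=\#\{j<i : w^{-1}(j)>w^{-1}(i)\}$. The middle order $\mathcal{P}_n$ is the poset on $S_n$ with $v\le w$ iff $I(v)\le I(w)$ coordinate-wise. For an inversion sequence $x$, an index $i$ is an ascent if $x_i<x_{i+1}$, a small ascent if $x_{i+1}=x_i+1$, and a large ascent otherwise; $x$ is slow-climbing if it has no large ascents; a permutation is slow-climbing if its inversion sequence is. The Möbius function of a finite poset is defined by $\mu(s,s)=1$, $\mu(s,u)=-\sum_{s\le t<u}\mu(s,t)$ for $s<u$, and $\mu(s,u)=0$ if $s\not\le u$. *)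

theory Defs
  imports Main "HOL-Combinatorics.Permutations"
begin

(* Posets are given by a carrier P together with a relation r, subject to partial_order_on P r
   (so r is a subset of P \<times> P). The guard is what makes the recursion terminate; outside
   finite posets the function has the junk value 0. *)

function moebius :: "'a set \<Rightarrow> 'a rel \<Rightarrow> 'a \<Rightarrow> 'a \<Rightarrow> int" where
  "moebius P r s u =
    (if finite P \<and> partial_order_on P r \<and> (s, u) \<in> r
     then (if s = u then 1
           else - (\<Sum>t\<in>{t \<in> P. (s, t) \<in> r \<and> (t, u) \<in> r \<and> t \<noteq> u}. moebius P r s t))
     else 0)"
  by pat_completeness auto
termination
proof (relation "measure (\<lambda>(P, r, s, u). card {t \<in> P. (t, u) \<in> r})", goal_cases)
  case 1
  show ?case by simp
next
  case (2 P r s u t)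
  then have fin: "finite P" and po: "partial_order_on P r"
    and t: "t \<in> P" "(t, u) \<in> r" "t \<noteq> u" by auto
  from po have trans: "trans r" and antisym: "antisym r" and refl: "refl_on P r"
    and sub: "r \<subseteq> P \<times> P"
    by (auto simp: partial_order_on_def preorder_on_def)
  have "u \<in> P" using t sub by auto
  then have "u \<in> {v \<in> P. (v, u) \<in> r}" using refl by (auto simp: refl_on_def)
  moreover have "u \<notin> {v \<in> P. (v, t) \<in> r}" using t antisym by (auto simp: antisym_def)
  moreover have "{v \<in> P. (v, t) \<in> r} \<subseteq> {v \<in> P. (v, u) \<in> r}"
    using t trans by (auto simp: trans_def)
  ultimately have "{v \<in> P. (v, t) \<in> r} \<subset> {v \<in> P. (v, u) \<in> r}" by blast
  then show ?case using fin by (auto intro!: psubset_card_mono)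
qed

declare moebius.simps [simp del]

lemma moebius_self:
  assumes "finite P" "partial_order_on P r" "s \<in> P"
  shows "moebius P r s s = 1"
  using assms by (subst moebius.simps)
    (auto simp: partial_order_on_def preorder_on_def refl_on_def)

lemma moebius_less:
  assumes "finite P" "partial_order_on P r" "(s, u) \<in> r" "s \<noteq> u"
  shows "moebius P r s u =
    - (\<Sum>t\<in>{t \<in> P. (s, t) \<in> r \<and> (t, u) \<in> r \<and> t \<noteq> u}. moebius P r s t)"
  using assms by (subst moebius.simps) simp

lemma moebius_not_le: "(s, u) \<notin> r \<Longrightarrow> moebius P r s u = 0"
  by (subst moebius.simps) simp

(* Permutations of size n are functions on nat with w permutes {1..n}; in particular they fix
   every number outside {1..n}, and e_n is id for every n. Entries of inversion sequences are
   indexed from 1, and only the indices in {1..n} are meaningful. *)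

definition inv_seq :: "(nat \<Rightarrow> nat) \<Rightarrow> nat \<Rightarrow> nat" where
  "inv_seq w i = card {j \<in> {1..<i}. inv w j > inv w i}"

definition perms :: "nat \<Rightarrow> (nat \<Rightarrow> nat) set" where
  "perms n = {w. w permutes {1..n}}"

definition middle_order :: "nat \<Rightarrow> (nat \<Rightarrow> nat) rel" where
  "middle_order n = {(v, w) \<in> perms n \<times> perms n. \<forall>i\<in>{1..n}. inv_seq v i \<le> inv_seq w i}"

definition involutions :: "nat \<Rightarrow> (nat \<Rightarrow> nat) set" where
  "involutions n = {w \<in> perms n. w \<circ> w = id}"

definition involution_order :: "nat \<Rightarrow> (nat \<Rightarrow> nat) rel" where
  "involution_order n = Restr (middle_order n) (involutions n)"

definition ascent :: "nat \<Rightarrow> (nat \<Rightarrow> nat) \<Rightarrow> nat \<Rightarrow> bool" where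
  "ascent n x i \<longleftrightarrow> i \<in> {1..<n} \<and> x i < x (i + 1)"

definition small_ascent :: "nat \<Rightarrow> (nat \<Rightarrow> nat) \<Rightarrow> nat \<Rightarrow> bool" where
  "small_ascent n x i \<longleftrightarrow> ascent n x i \<and> x (i + 1) = x i + 1"

definition large_ascent :: "nat \<Rightarrow> (nat \<Rightarrow> nat) \<Rightarrow> nat \<Rightarrow> bool" where
  "large_ascent n x i \<longleftrightarrow> ascent n x i \<and> \<not> small_ascent n x i"

definition slow_climbing_seq :: "nat \<Rightarrow> (nat \<Rightarrow> nat) \<Rightarrow> bool" where
  "slow_climbing_seq n x \<longleftrightarrow> \<not> (\<exists>i. large_ascent n x i)"

definition slow_climbing :: "nat \<Rightarrow> (nat \<Rightarrow> nat) \<Rightarrow> bool" where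
  "slow_climbing n w \<longleftrightarrow> slow_climbing_seq n (inv_seq w)"

end

theory Submission
  imports Defs
begin

text \<open>The slow-climbing involutions are the direct sums of reversals: their inversion sequences
  consist of runs \<open>0, 1, \<dots>, k\<close>, and they correspond to the subsets \<open>S\<close> of \<open>{2..n}\<close> of positions
  with nonzero entry. The claim is thus that for an involution \<open>u \<noteq> id\<close> the sum of \<open>(-1)\<close> to the
  power \<open>card S\<close>, over all \<open>S\<close> whose sequence lies below that of \<open>u\<close>, vanishes. These \<open>S\<close> form a
  simplicial complex which is a cone: its apex is the last point \<open>j\<close> moved by \<open>u\<close>, because the
  number \<open>i\<close> minus the \<open>i\<close>-th entry of the inversion sequence is constant on the cycles of \<open>u\<close>.\<close>

section \<open>Moebius inversion and alternating sums\<close>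

text \<open>The recursion determines the Moebius function from \<open>s\<close> upwards, so
  normalisation at \<open>s\<close> and vanishing sums over closed intervals suffice. The induction
  measure is the one that makes \<open>moebius\<close> terminate.\<close>

lemma moebius_eqI:
  assumes fin: "finite P" and po: "partial_order_on P r"
    and s: "f s = 1" and su: "(s, u) \<in> r"
    and sum: "\<And>u. (s, u) \<in> r \<Longrightarrow> s \<noteq> u \<Longrightarrow> (\<Sum>t\<in>{t \<in> P. (s, t) \<in> r \<and> (t, u) \<in> r}. f t) = 0"
  shows "moebius P r s u = f u"
  using su
proof (induction "card {t \<in> P. (t, u) \<in> r}" arbitrary: u rule: less_induct)
  case (less u)
  from po have trans: "trans r" and antisym: "antisym r" and refl: "refl_on P r"
    and sub: "r \<subseteq> P \<times> P"
    by (auto simp: partial_order_on_def preorder_on_def)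
  have sP: "s \<in> P" and uP: "u \<in> P" using less.prems sub by auto
  show ?case
  proof (cases "s = u")
    case True
    then show ?thesis using moebius_self[OF fin po] s sP by simp
  next
    case False
    let ?B = "{t \<in> P. (s, t) \<in> r \<and> (t, u) \<in> r \<and> t \<noteq> u}"
    have IH: "moebius P r s t = f t" if "t \<in> ?B" for t
    proof (rule less.hyps)
      have "u \<in> {v \<in> P. (v, u) \<in> r}" using refl uP by (auto simp: refl_on_def)
      moreover have "u \<notin> {v \<in> P. (v, t) \<in> r}" using that antisym by (auto simp: antisym_def)
      moreover have "{v \<in> P. (v, t) \<in> r} \<subseteq> {v \<in> P. (v, u) \<in> r}"
        using that trans by (auto simp: trans_def)
      ultimately show "card {v \<in> P. (v, t) \<in> r} < card {v \<in> P. (v, u) \<in> r}"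
        using fin by (intro psubset_card_mono) auto
      show "(s, t) \<in> r" using that by simp
    qed
    have "{t \<in> P. (s, t) \<in> r \<and> (t, u) \<in> r} = insert u ?B"
      using uP less.prems refl by (auto simp: refl_on_def)
    then have "f u + sum f ?B = 0"
      using sum[OF less.prems False] fin by simp
    moreover have "moebius P r s u = - sum f ?B"
      unfolding moebius_less[OF fin po less.prems False] using IH by simp
    ultimately show ?thesis by simp
  qed
qed

text \<open>Toggling membership of \<open>j\<close> is a sign-reversing involution of
  \<open>F\<close> without fixed points.\<close>

lemma alternating_sum_eq_0:
  assumes ins: "\<And>S. S \<in> F \<Longrightarrow> insert j S \<in> F" and del: "\<And>S. S \<in> F \<Longrightarrow> S - {j} \<in> F"
    and fin: "\<And>S. S \<in> F \<Longrightarrow> finite S"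
  shows "(\<Sum>S\<in>F. (-1) ^ card S) = (0::int)"
proof -
  let ?t = "\<lambda>S. if j \<in> S then S - {j} else insert j S"
  have "bij_betw ?t F F"
    by (rule bij_betw_byWitness[where f' = ?t]) (use ins del in \<open>auto simp: insert_absorb\<close>)
  then have "(\<Sum>S\<in>F. (-1) ^ card S) = (\<Sum>S\<in>F. (-1) ^ card (?t S) :: int)"
    by (rule sum.reindex_bij_betw[symmetric])
  also have "\<dots> = (\<Sum>S\<in>F. - ((-1) ^ card S))"
  proof (rule sum.cong)
    fix S assume "S \<in> F"
    have "finite S" using \<open>S \<in> F\<close> by (rule fin)
    show "(-1) ^ card (?t S) = - ((-1) ^ card S :: int)"
    proof (cases "j \<in> S")
      case True
      then have "card S = Suc (card (S - {j}))" using \<open>finite S\<close> by (rule card.remove[rotated])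
      then show ?thesis using True by (simp del: card_Diff_insert card_Diff_singleton)
    qed (use \<open>finite S\<close> in simp)
  qed simp
  finally show ?thesis by (simp add: sum_negf)
qed

lemma bij_betw_restrict_image:
  assumes "bij_betw f A B" "C \<subseteq> B"
  shows "bij_betw f {x \<in> A. f x \<in> C} C"
  using assms by (auto simp: bij_betw_def intro: inj_on_subset)

section \<open>Inversion and coinversion sequences\<close>

text \<open>Closed range and weak comparison make \<open>i\<close> count itself, so that this is
  exactly \<open>i\<close> minus the inversion entry.\<close>

definition coinv_seq :: "(nat \<Rightarrow> nat) \<Rightarrow> nat \<Rightarrow> nat" where
  "coinv_seq w i = card {j \<in> {1..i}. inv w j \<le> inv w i}"

lemma inv_seq_add_coinv_seq: "inv_seq w i + coinv_seq w i = i"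
proof -
  let ?A = "{j \<in> {1..<i}. inv w j > inv w i}" and ?B = "{j \<in> {1..i}. inv w j \<le> inv w i}"
  have "?A \<union> ?B = {1..i}" by (auto simp: not_less le_less)
  moreover have "card (?A \<union> ?B) = card ?A + card ?B" by (rule card_Un_disjoint) auto
  ultimately have "card ?A + card ?B = card {1..i}" by argo
  then show ?thesis by (simp add: inv_seq_def coinv_seq_def)
qed

text \<open>At the largest \<open>p\<close> where the inverses differ, both map
  \<open>{1..p}\<close> onto the same set. The entry at \<open>p\<close> gives the rank of the value
  at \<open>p\<close> in that set, hence the value itself.\<close>

lemma inv_seq_inj:
  assumes "v \<in> perms n" "w \<in> perms n" "\<And>i. i \<in> {1..n} \<Longrightarrow> inv_seq v i = inv_seq w i"
  shows "v = w"
proof (rule ccontr)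
  assume "v \<noteq> w"
  define V where "V = inv v"
  define W where "W = inv w"
  have v: "v permutes {1..n}" and w: "w permutes {1..n}" using assms by (auto simp: perms_def)
  have V: "V permutes {1..n}" and W: "W permutes {1..n}"
    using v w by (auto simp: V_def W_def permutes_inv)
  define D where "D = {p. V p \<noteq> W p}"
  have "V \<noteq> W" using \<open>v \<noteq> w\<close> v w by (metis V_def W_def permutes_inv_inv)
  then have "D \<noteq> {}" by (auto simp: D_def)
  have D: "D \<subseteq> {1..n}"
    using permutes_not_in[OF V] permutes_not_in[OF W] unfolding D_def by force
  define p where "p = Max D"
  have finD: "finite D" using D finite_subset by blast
  have pD: "p \<in> D" using finD \<open>D \<noteq> {}\<close> by (simp add: p_def)
  have pn: "p \<in> {1..n}" using D pD by auto
  have above: "V q = W q" if "q > p" for q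
  proof (rule ccontr)
    assume "V q \<noteq> W q"
    then have "q \<le> p" unfolding p_def by (intro Max_ge[OF finD]) (simp add: D_def)
    with that show False by simp
  qed
  have img: "V ` {1..p} = W ` {1..p}"
  proof -
    have "V ` {1..p} = {1..n} - V ` {p<..n}" if "V permutes {1..n}" for V :: "nat \<Rightarrow> nat"
    proof -
      have "{1..p} = {1..n} - {p<..n}" using pn by auto
      then show ?thesis
        using image_set_diff[OF permutes_inj[OF that]] permutes_image[OF that] by metis
    qed
    moreover have "V ` {p<..n} = W ` {p<..n}" using above by (intro image_cong) auto
    ultimately show ?thesis using V W by metis
  qed
  have count: "inv_seq (inv U) p = card {a \<in> U ` {1..p}. a > U p}" if "U permutes {1..n}" for U
  proof -
    have "{a \<in> U ` {1..p}. a > U p} = U ` {j \<in> {1..<p}. U j > U p}"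
      by (auto simp: less_le)
    then show ?thesis
      using card_image[OF inj_on_subset[OF permutes_inj[OF that] subset_UNIV]]
      by (simp add: inv_seq_def permutes_inv_inv[OF that])
  qed
  have eq: "card {a \<in> V ` {1..p}. a > V p} = card {a \<in> V ` {1..p}. a > W p}"
    using count[OF V] count[OF W] assms(3)[OF pn] img permutes_inv_inv[OF v] permutes_inv_inv[OF w]
    by (simp add: V_def W_def)
  have mem: "V p \<in> V ` {1..p}" "W p \<in> V ` {1..p}" using pn img by auto
  have strict: "card {a \<in> A. a > y} < card {a \<in> A. a > x}"
    if "finite A" "y \<in> A" "x < y" for A and x y :: nat
    using that by (intro psubset_card_mono) auto
  have "V p \<noteq> W p" using pD by (simp add: D_def)
  then consider "V p < W p" | "W p < V p" by linarith
  then show False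
  proof cases
    case 1
    show False using strict[OF _ mem(2) 1] eq by simp
  next
    case 2
    show False using strict[OF _ mem(1) 2] eq by simp
  qed
qed

lemma involutionsD:
  assumes "w \<in> involutions n"
  shows "w permutes {1..n}" "w (w i) = i" "inv w = w"
proof -
  show "w permutes {1..n}" "w (w i) = i"
    using assms by (auto simp: involutions_def perms_def fun_eq_iff)
  show "inv w = w"
    using assms by (auto simp: involutions_def intro: inv_unique_comp)
qed

text \<open>As \<open>w\<close> is its own inverse, applying it swaps the conditions on
  \<open>j\<close> and on \<open>w j\<close>, and so maps one counted set onto the other.\<close>

lemma coinv_seq_involution:
  assumes "w \<in> involutions n"
  shows "coinv_seq w (w i) = coinv_seq w i"
proof -
  note w = involutionsD[OF assms]
  \<comment> \<open>Fixing 0 is what lets \<open>w\<close> respect the lower bound 1 of the counted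
    ranges.\<close>
  have "w 0 = 0" using permutes_not_in[OF w(1)] by simp
  then have pos: "1 \<le> w j \<longleftrightarrow> 1 \<le> j" for j using w(2) by (metis less_one linorder_not_le)
  have "bij_betw w {j \<in> {1..w i}. w j \<le> i} {j \<in> {1..i}. w j \<le> w i}"
    by (rule bij_betw_byWitness[where f' = w]) (use w(2) pos in auto)
  then show ?thesis by (simp add: coinv_seq_def w bij_betw_same_card)
qed

lemma coinv_seq_le: "coinv_seq w i \<le> i"
  using inv_seq_add_coinv_seq[of w i] by simp

lemma coinv_seq_le_image:
  assumes "w \<in> involutions n"
  shows "coinv_seq w i \<le> w i"
  using coinv_seq_le[of w "w i"] coinv_seq_involution[OF assms] by simp

lemma inv_seq_outside:
  assumes "w \<in> involutions n" "\<And>q. q \<ge> i \<Longrightarrow> w q = q"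
  shows "inv_seq w i = 0"
proof -
  note w = involutionsD[OF assms(1)]
  have "w j \<le> i" if "j < i" for j
    using assms(2)[of "w j"] w(2) that by (metis nat_le_linear not_less)
  then have "{j \<in> {1..<i}. w j > w i} = {}" using assms(2)[of i] by (auto simp: not_less[symmetric] dest: leD)
  then show ?thesis by (simp only: inv_seq_def w card.empty)
qed

section \<open>Runs and the involutions realising them\<close>

text \<open>Length of the maximal block of consecutive positive members of \<open>S\<close> ending
  at \<open>i\<close>. With \<open>1 \<notin> S\<close> this is the only possible slow-climbing
  inversion sequence of an involution with nonzero positions \<open>S\<close>.\<close>

fun run :: "nat set \<Rightarrow> nat \<Rightarrow> nat" where
  "run S 0 = 0"
| "run S (Suc i) = (if Suc i \<in> S then Suc (run S i) else 0)"

lemma run_eq_0_iff: "i \<ge> 1 \<Longrightarrow> run S i = 0 \<longleftrightarrow> i \<notin> S"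
  by (cases i) auto

lemma run_mono: "S \<subseteq> S' \<Longrightarrow> run S i \<le> run S' i"
  by (induction i) auto

lemma run_cong: "(\<And>q. q \<in> {1..i} \<Longrightarrow> q \<in> S \<longleftrightarrow> q \<in> S') \<Longrightarrow> run S i = run S' i"
  by (induction i) auto

text \<open>All positions passed on the way back lie in \<open>S\<close>, so each step undoes one
  increment.\<close>

lemma run_diff: "t \<le> run S i \<Longrightarrow> run S (i - t) = run S i - t"
proof (induction t)
  case (Suc t)
  then have "run S (i - t) = run S i - t" "run S i - t > 0" by auto
  then show ?case by (cases "i - t") (auto split: if_splits nat.split simp: diff_Suc)
qed simp

lemma run_less: "1 \<notin> S \<Longrightarrow> i \<ge> 1 \<Longrightarrow> run S i < i"
proof (induction i)
  case (Suc i)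
  then show ?case by (cases i) auto
qed simp

text \<open>The involution is a direct sum of reversals: the last block is reversed, and induction
  handles the points before it.\<close>

lemma exists_involution_run:
  assumes "1 \<notin> S"
  shows "\<exists>w\<in>involutions n. \<forall>i\<in>{1..n}. inv_seq w i = run S i"
proof (induction n rule: less_induct)
  case (less n)
  show ?case
  proof (cases "n = 0")
    case True
    then show ?thesis by (intro bexI[of _ id]) (auto simp: involutions_def perms_def permutes_id)
  next
    case False
    \<comment> \<open>The last block starts at the zero entry preceding the final run;
      \<open>run_less\<close> keeps it at 1 or later.\<close>
    define s where "s = n - run S n"
    have s: "1 \<le> s" "s \<le> n" using run_less[OF assms, of n] False by (auto simp: s_def)
    obtain v where v: "v \<in> involutions (s - 1)" "\<forall>i\<in>{1..s - 1}. inv_seq v i = run S i"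
      using less[of "s - 1"] s by (metis Suc_diff_1 lessI less_le_trans less_eq_Suc_le One_nat_def)
    note vv = involutionsD[OF v(1)]
    define w where "w = (\<lambda>i. if s \<le> i \<and> i \<le> n then s + n - i else v i)"
    have vr: "v i < s \<longleftrightarrow> i < s" for i
      using permutes_in_image[OF vv(1), of i] permutes_not_in[OF vv(1), of i] s
      by (cases "i \<in> {1..s-1}") auto
    have vo: "v i = i" if "i \<ge> s" for i
      using permutes_not_in[OF vv(1), of i] s that by auto
    have ww: "w (w i) = i" for i
      using vr[of i] vr[of "v i"] vv(2)[of i] vo[of i] by (auto simp: w_def)
    have v0: "v 0 = 0" using permutes_not_in[OF vv(1), of 0] by simp
    have "w permutes {1..n}"
      unfolding permutes_def
    proof (intro conjI allI impI)
      fix x assume "x \<notin> {1..n}"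
      then show "w x = x" using s v0 vo[of x] by (auto simp: w_def not_le)
    next
      fix y show "\<exists>!x. w x = y" using ww by metis
    qed
    then have wi: "w \<in> involutions n"
      using ww by (auto simp: involutions_def perms_def fun_eq_iff)
    have "inv_seq w i = run S i" if i: "i \<in> {1..n}" for i
    proof (cases "i < s")
      case True
      then have "{j \<in> {1..<i}. w i < w j} = {j \<in> {1..<i}. v i < v j}"
        by (auto simp: w_def)
      then have "inv_seq w i = inv_seq v i"
        by (simp only: inv_seq_def vv(3) involutionsD(3)[OF wi])
      then show ?thesis using v(2) i True by auto
    next
      case False
      \<comment> \<open>Inside the reversed block, \<open>i\<close> is inverted with all earlier
        block members, and with nothing before the block.\<close>
      have "{j \<in> {1..<i}. w i < w j} = {s..<i}"
      proof (rule set_eqI)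
        fix j
        show "j \<in> {j \<in> {1..<i}. w i < w j} \<longleftrightarrow> j \<in> {s..<i}"
        proof (cases "j < s")
          case True
          then have "w j < s" using vr[of j] by (simp add: w_def)
          moreover have "s \<le> w i" using False i by (auto simp: w_def)
          ultimately show ?thesis using True by simp
        qed (use False i s in \<open>auto simp: w_def\<close>)
      qed
      then have "inv_seq w i = i - s"
        by (simp add: inv_seq_def involutionsD(3)[OF wi])
      moreover have "run S (n - (n - i)) = run S n - (n - i)"
        by (rule run_diff) (use False s_def i in auto)
      ultimately show ?thesis using i False s by (auto simp: s_def)
    qed
    then show ?thesis using wi by blast
  qed
qed

section \<open>Slow-climbing involutions as subsets of \<open>{2..n}\<close>\<close>

definition support :: "nat \<Rightarrow> (nat \<Rightarrow> nat) \<Rightarrow> nat set" where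
  "support n w = {i \<in> {1..n}. inv_seq w i \<noteq> 0}"

lemma inv_seq_1 [simp]: "inv_seq w (Suc 0) = 0" and inv_seq_0 [simp]: "inv_seq w 0 = 0"
  by (simp_all add: inv_seq_def)

lemma support_subset: "support n w \<subseteq> {2..n}"
proof
  fix i assume i: "i \<in> support n w"
  then have "i \<noteq> Suc 0" by (auto simp: support_def intro: ccontr)
  with i show "i \<in> {2..n}" by (auto simp: support_def)
qed

text \<open>For a slow-climbing involution the coinversion sequence is weakly increasing, so its
  fibres are intervals; being invariant under \<open>w\<close>, they are the blocks of \<open>w\<close>.\<close>

lemma slow_climbing_step:
  assumes w: "w \<in> involutions n" and slow: "slow_climbing n w" and i: "1 \<le> i" "i < n"
  shows "inv_seq w (Suc i) = 0 \<or> inv_seq w (Suc i) = Suc (inv_seq w i)"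
proof -
  note ww = involutionsD[OF w]
  have le_Suc: "coinv_seq w q \<le> coinv_seq w (Suc q)" if "q \<in> {1..<n}" for q
  proof -
    have "inv_seq w (Suc q) \<le> Suc (inv_seq w q)"
      using slow that
      by (cases "inv_seq w q < inv_seq w (Suc q)")
        (auto simp: slow_climbing_def slow_climbing_seq_def large_ascent_def ascent_def
          small_ascent_def)
    then show ?thesis
      using inv_seq_add_coinv_seq[of w q] inv_seq_add_coinv_seq[of w "Suc q"] by linarith
  qed
  have mono: "coinv_seq w p \<le> coinv_seq w q" if "1 \<le> p" "p \<le> q" "q \<le> n" for p q
    using that(2,1,3)
  proof (induction q rule: dec_induct)
    case (step q)
    then show ?case using le_Suc[of q] by simp
  qed simp
  show ?thesis
  proof (cases "coinv_seq w (Suc i) = coinv_seq w i")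
    case True
    then show ?thesis
      using inv_seq_add_coinv_seq[of w i] inv_seq_add_coinv_seq[of w "Suc i"] by linarith
  next
    case False
    then have lt: "coinv_seq w i < coinv_seq w (Suc i)" using le_Suc[of i] i by auto
    \<comment> \<open>Up to \<open>i\<close> the coinversion values lie strictly below the value at
      \<open>Suc i\<close>. Invariance under \<open>w\<close> carries this to the images, and
      monotonicity then orders the images themselves.\<close>
    have fibre: "w q \<le> w (Suc i)" if q: "q \<in> {1..i}" for q
    proof -
      have "w q \<in> {1..n}" "w (Suc i) \<in> {1..n}"
        using permutes_in_image[OF ww(1)] q i by auto
      moreover have "coinv_seq w (w q) < coinv_seq w (w (Suc i))"
        using mono[of q i] q i lt coinv_seq_involution[OF w] by auto
      ultimately show ?thesis using mono[of "w (Suc i)" "w q"] by force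
    qed
    have "{j \<in> {1..<Suc i}. w (Suc i) < w j} = {}" using fibre by (simp add: less_Suc_eq_le set_eq_iff not_less)
    then have "inv_seq w (Suc i) = 0" by (simp only: inv_seq_def ww(3) card.empty)
    then show ?thesis ..
  qed
qed

text \<open>The alternative between 0 and one more than the previous entry is the recursion of
  \<open>run\<close>, so the support determines the whole sequence.\<close>

lemma slow_climbing_run:
  assumes w: "w \<in> involutions n" and slow: "slow_climbing n w" and "i \<le> n"
  shows "inv_seq w i = run (support n w) i"
  using assms(3)
proof (induction i)
  case (Suc i)
  show ?case
  proof (cases "i = 0")
    case True
    then have "Suc i \<notin> support n w" using support_subset[of n w] by auto
    then show ?thesis using True by simp
  next
    case False
    then have "inv_seq w (Suc i) = 0 \<or> inv_seq w (Suc i) = Suc (inv_seq w i)"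
      using slow_climbing_step[OF w slow] Suc.prems by auto
    moreover have "Suc i \<in> support n w \<longleftrightarrow> inv_seq w (Suc i) \<noteq> 0"
      using Suc.prems by (simp add: support_def)
    moreover have "inv_seq w i = run (support n w) i" using Suc by simp
    ultimately show ?thesis by (metis run.simps(2))
  qed
qed simp

lemma run_slow_climbing:
  assumes "\<And>i. i \<in> {1..n} \<Longrightarrow> inv_seq w i = run S i"
  shows "slow_climbing n w"
  using assms by (auto simp: slow_climbing_def slow_climbing_seq_def large_ascent_def
    small_ascent_def ascent_def split: if_splits)

text \<open>Injectivity: the support determines the inversion sequence, which determines the
  permutation. Surjectivity: direct sums of reversals realise every subset.\<close>

lemma bij_betw_support:
  "bij_betw (support n) {w \<in> involutions n. slow_climbing n w} (Pow {2..n})"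
  unfolding bij_betw_def
proof
  show "inj_on (support n) {w \<in> involutions n. slow_climbing n w}"
  proof (rule inj_onI)
    fix v w assume v: "v \<in> {w \<in> involutions n. slow_climbing n w}"
      and w: "w \<in> {w \<in> involutions n. slow_climbing n w}" and eq: "support n v = support n w"
    show "v = w"
    proof (rule inv_seq_inj)
      show "v \<in> perms n" "w \<in> perms n" using v w by (simp_all add: involutions_def)
      show "inv_seq v i = inv_seq w i" if "i \<in> {1..n}" for i
        using slow_climbing_run[of v n i] slow_climbing_run[of w n i] v w eq that by simp
    qed
  qed
  show "support n ` {w \<in> involutions n. slow_climbing n w} = Pow {2..n}"
  proof (intro equalityI subsetI)
    fix S assume "S \<in> Pow {2..n}"
    then have S: "S \<subseteq> {2..n}" by simp
    then have "1 \<notin> S" by auto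
    then obtain w where w: "w \<in> involutions n" "\<forall>i\<in>{1..n}. inv_seq w i = run S i"
      using exists_involution_run by blast
    have "support n w = S"
    proof -
      have "i \<in> support n w \<longleftrightarrow> i \<in> S" if "i \<in> {1..n}" for i
        using that w(2) run_eq_0_iff[of i S] by (auto simp: support_def)
      moreover have "S \<subseteq> {1..n}" "support n w \<subseteq> {1..n}"
        using S by (auto simp: support_def)
      ultimately show ?thesis by blast
    qed
    then show "S \<in> support n ` {w \<in> involutions n. slow_climbing n w}"
      using w run_slow_climbing[of n w S] by blast
  qed (use support_subset in blast)
qed

section \<open>The cone below an involution\<close>

text \<open>If a run of \<open>S\<close> reaches \<open>j - 1\<close> from the start \<open>i\<close>, then \<open>coinv_seq u \<le> i\<close> strictly between
  \<open>i\<close> and \<open>j\<close>. Were \<open>coinv_seq u j > i\<close>, then \<open>u j\<close> would lie strictly between \<open>i\<close> and \<open>j\<close>, and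
  \<open>coinv_seq u (u j) = coinv_seq u j\<close> gives a contradiction.\<close>

lemma run_extend:
  assumes u: "u \<in> involutions n" and j: "u j < j" "j \<le> n" and S: "1 \<notin> S"
    and le: "\<And>q. q \<in> {1..<j} \<Longrightarrow> run S q \<le> inv_seq u q"
  shows "Suc (run S (j - 1)) \<le> inv_seq u j"
proof (rule ccontr)
  note uu = involutionsD[OF u]
  assume not: "\<not> ?thesis"
  define t where "t = run S (j - 1)"
  have "u j \<in> {1..n}"
    using permutes_in_image[OF uu(1), of j] j by auto
  then have j2: "j \<ge> 2" using j by auto
  have t: "t < j - 1" using run_less[OF S, of "j - 1"] j2 by (simp add: t_def)
  have eq: "inv_seq u j + coinv_seq u j = j"
    "inv_seq u (u j) + coinv_seq u j = u j"
    using inv_seq_add_coinv_seq[of u j] inv_seq_add_coinv_seq[of u "u j"]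
      coinv_seq_involution[OF u, of j] by auto
  have "coinv_seq u j \<le> u j" by (rule coinv_seq_le_image[OF u])
  \<comment> \<open>Here \<open>j - 1 - t\<close> is the zero before the run, so \<open>u j\<close>
    lies inside the run.\<close>
  then have lt: "j - 1 - t < u j" using eq not t unfolding t_def by linarith
  have "run S (j - 1 - (j - 1 - u j)) = t - (j - 1 - u j)"
    unfolding t_def by (rule run_diff) (use lt in \<open>auto simp: t_def\<close>)
  then have "run S (u j) = t - (j - 1 - u j)" using j by simp
  \<comment> \<open>This bounds the coinversion value at \<open>u j\<close> by
    \<open>j - 1 - t\<close>, but the same value at \<open>j\<close> is at least
    \<open>j - t\<close>.\<close>
  moreover have "run S (u j) \<le> inv_seq u (u j)" using le \<open>u j \<in> {1..n}\<close> j by auto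
  ultimately show False using not eq lt j unfolding t_def by linarith
qed

text \<open>Supplies the apex \<open>j\<close>. Since \<open>u\<close> permutes its moved points, it
  sends the largest one downwards; later points are fixed and have entry 0.\<close>

lemma last_moved_point:
  assumes u: "u \<in> involutions n" and "u \<noteq> id"
  obtains j where "j \<in> {2..n}" "u j < j" "\<And>i. j < i \<Longrightarrow> inv_seq u i = 0"
proof
  note uu = involutionsD[OF u]
  define D where "D = {p. u p \<noteq> p}"
  have D: "D \<subseteq> {1..n}" using uu(1) by (auto simp: D_def permutes_def)
  then have fin: "finite D" using finite_subset by blast
  have "D \<noteq> {}" using \<open>u \<noteq> id\<close> by (auto simp: D_def)
  define j where "j = Max D"
  have jD: "j \<in> D" using fin \<open>D \<noteq> {}\<close> by (simp add: j_def)
  have "u j \<in> D" using jD uu(2) by (auto simp: D_def)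
  then have "u j \<le> j" unfolding j_def by (rule Max_ge[OF fin])
  then show "u j < j" using jD by (simp add: D_def)
  moreover have "u j \<ge> 1" using \<open>u j \<in> D\<close> D by auto
  ultimately show "j \<in> {2..n}" using jD D by auto
  have "u q = q" if "q > j" for q
    using that Max_ge[OF fin, of q] by (auto simp: j_def D_def)
  then show "inv_seq u i = 0" if "j < i" for i
    using that inv_seq_outside[OF u, of i] by auto
qed

text \<open>Deleting \<open>j\<close> only shortens runs. Inserting it leaves the entries before
  \<open>j\<close> alone, and \<open>run_extend\<close> controls the entry at
  \<open>j\<close>.\<close>

lemma alternating_sum_run_bounded:
  assumes u: "u \<in> involutions n" and "u \<noteq> id"
  shows "(\<Sum>S\<in>{S \<in> Pow {2..n}. \<forall>i\<in>{1..n}. run S i \<le> inv_seq u i}. (-1) ^ card S) = (0::int)"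
proof -
  obtain j where j: "j \<in> {2..n}" "u j < j" and above: "\<And>i. j < i \<Longrightarrow> inv_seq u i = 0"
    using last_moved_point[OF assms] by blast
  show ?thesis
  proof (rule alternating_sum_eq_0[where j = j])
    fix S assume S: "S \<in> {S \<in> Pow {2..n}. \<forall>i\<in>{1..n}. run S i \<le> inv_seq u i}"
    then show "S - {j} \<in> {S \<in> Pow {2..n}. \<forall>i\<in>{1..n}. run S i \<le> inv_seq u i}"
      using run_mono[of "S - {j}" S] by (force intro: order_trans)
    show "finite S" using S finite_subset by blast
    have S1: "1 \<notin> S" and le: "\<And>i. i \<in> {1..n} \<Longrightarrow> run S i \<le> inv_seq u i" using S by auto
    have "run (insert j S) i \<le> inv_seq u i" if i: "i \<in> {1..n}" for i
    proof (cases i j rule: linorder_cases)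
      case less
      then have "run (insert j S) i = run S i" by (intro run_cong) auto
      then show ?thesis using le i by simp
    next
      case equal
      have "run (insert j S) (j - 1) = run S (j - 1)" using j by (intro run_cong) auto
      then have "run (insert j S) j = Suc (run S (j - 1))" using j by (cases j) auto
      then show ?thesis using run_extend[OF u j(2) _ S1] le j equal by auto
    next
      case greater
      \<comment> \<open>The zero entries of \<open>u\<close> past \<open>j\<close> keep
        \<open>S\<close> out of there, so the run through \<open>j\<close> stops at
        \<open>j\<close>.\<close>
      then have "i \<notin> insert j S" using le[OF i] above[of i] run_eq_0_iff[of i S] i by auto
      then show ?thesis using run_eq_0_iff[of i "insert j S"] i by auto
    qed
    then show "insert j S \<in> {S \<in> Pow {2..n}. \<forall>i\<in>{1..n}. run S i \<le> inv_seq u i}"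
      using S j by auto
  qed
qed

section \<open>The poset of involutions and its Moebius function\<close>

lemma involution_order_iff:
  "(v, w) \<in> involution_order n \<longleftrightarrow>
    v \<in> involutions n \<and> w \<in> involutions n \<and> (\<forall>i\<in>{1..n}. inv_seq v i \<le> inv_seq w i)"
  by (auto simp: involution_order_def middle_order_def involutions_def)

lemma finite_involutions: "finite (involutions n)"
  by (rule finite_subset[OF _ finite_permutations[of "{1..n}"]])
    (auto simp: involutions_def perms_def)

lemma partial_order_involution_order: "partial_order_on (involutions n) (involution_order n)"
proof -
  have "antisym (involution_order n)"
  proof (rule antisymI)
    fix v w assume "(v, w) \<in> involution_order n" "(w, v) \<in> involution_order n"
    then show "v = w"
      by (intro inv_seq_inj[of v n w]) (auto simp: involution_order_iff involutions_def intro: antisym)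
  qed
  moreover have "trans (involution_order n)"
    by (rule transI) (auto simp: involution_order_iff intro: order_trans)
  ultimately show ?thesis
    by (auto simp: partial_order_on_def preorder_on_def refl_on_def involution_order_iff)
qed

theorem theorem5p6:
  fixes n :: nat and w :: "nat \<Rightarrow> nat"
  assumes "w \<in> involutions n"
  defines "\<alpha> \<equiv> card {i \<in> {1..n}. inv_seq w i \<noteq> 0}"
  shows "moebius (involutions n) (involution_order n) id w =
    (if slow_climbing n w then (-1) ^ \<alpha> else 0)"
proof -
  let ?f = "\<lambda>w. if slow_climbing n w then (-1) ^ card (support n w) else (0::int)"
  have id: "id \<in> involutions n" by (auto simp: involutions_def perms_def permutes_id)
  have inv_id: "inv_seq id i = 0" for i by (auto simp: inv_seq_def)
  have id_le: "(id, v) \<in> involution_order n" if "v \<in> involutions n" for v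
    using that id by (simp add: involution_order_iff inv_id)
  have "moebius (involutions n) (involution_order n) id w = ?f w"
  proof (rule moebius_eqI[OF finite_involutions partial_order_involution_order])
    \<comment> \<open>The zero sequence is the run sequence of the empty set.\<close>
    show "?f id = 1"
      using run_slow_climbing[of n id "{}"]
      by (auto simp: support_def inv_id run_eq_0_iff)
    show "(id, w) \<in> involution_order n" using id_le assms by simp
  next
    fix u assume "(id, u) \<in> involution_order n" "id \<noteq> u"
    then have u: "u \<in> involutions n" "u \<noteq> id" by (auto simp: involution_order_iff)
    let ?F = "{S \<in> Pow {2..n}. \<forall>i\<in>{1..n}. run S i \<le> inv_seq u i}"
    let ?V = "{v \<in> involutions n. slow_climbing n v \<and> (v, u) \<in> involution_order n}"
    have "bij_betw (support n) ?V ?F"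
    proof -
      have le_iff: "(v, u) \<in> involution_order n \<longleftrightarrow>
        (\<forall>i\<in>{1..n}. run (support n v) i \<le> inv_seq u i)"
        if "v \<in> involutions n" "slow_climbing n v" for v
        using that u by (auto simp: involution_order_iff slow_climbing_run)
      have "?V = {v \<in> {w \<in> involutions n. slow_climbing n w}. support n v \<in> ?F}"
        using le_iff support_subset by (auto 4 0)
      moreover have "?F \<subseteq> Pow {2..n}" by blast
      ultimately show ?thesis
        using bij_betw_restrict_image[OF bij_betw_support, of ?F n] by (simp only:)
    qed
    \<comment> \<open>Terms that are not slow-climbing vanish, and the lower bound \<open>id\<close>
      imposes no condition.\<close>
    have "(\<Sum>t\<in>{t \<in> involutions n. (id, t) \<in> involution_order n \<and> (t, u) \<in> involution_order n}. ?f t)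
        = (\<Sum>v\<in>?V. (-1) ^ card (support n v))"
      by (rule sum.mono_neutral_cong_right)
        (use finite_involutions id_le in auto)
    also have "\<dots> = (\<Sum>S\<in>?F. (-1) ^ card S)"
      by (rule sum.reindex_bij_betw) fact
    also have "\<dots> = 0" by (rule alternating_sum_run_bounded[OF u])
    finally show "(\<Sum>t\<in>{t \<in> involutions n. (id, t) \<in> involution_order n \<and> (t, u) \<in> involution_order n}. ?f t) = 0" .
  qed
  then show ?thesis by (simp add: \<alpha>_def support_def)
qed

end
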